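(* Let $G$ be a finite simple graph embedded in a closed surface and let $\mathcal F\neq \mathcal F(G)$ be a set of even faces of $G$. Then every connected component of the resonance graph $R(G;\mathcal F)$ is an induced cubical graph.
   Context: A closed surface is a compact connected 2-dimensional manifold without boundary; an embedding maps vertices to distinct points and edges to simple arcs joining the points of their end-vertices (arcs meeting only at common end-points). A face of $G$ is the closure of a connected component of $\Sigma\setminus G$; $E(f)$ denotes the set of edges on the boundary of face $f$, and $\mathcal F(G)$ denotes the set of all faces of $G$. A face is even if its boundary is a cycle of even length. For a set $\mathcal F$ of even faces, the resonance graph $R(G;\mathcal F)$ has as vertex set the set of all perfect matchings of $G$, and two perfect matchings $M_1,M_2$ are adjacent iff the symmetric difference $M_1\oplus M_2$ equals $E(f)$ (the boundary cycle of $f$) for some face $f\in\mathcal F$. A graph $H$ is an induced cubical graph if there exist $n\ge 1$ and an injective map $\ell:V(H)\to V(Q_n)$ into the vertex set of the $n$-dimensional hypercube $Q_n$ (binary strings of length $n$, adjacent iff they differ in exactly one position) such that for all $x,y\in V(H)$, $\ell(x)\ell(y)\in E(Q_n)$ if and only if $xy\in E(H)$. *)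

theory Defs
  imports "HOL-Analysis.Analysis"
begin

record 'a sgraph =
  gverts :: "'a set"
  gedges :: "'a set set"

definition simple_graph :: "'a sgraph \<Rightarrow> bool" where
  "simple_graph G \<longleftrightarrow> (\<forall>e\<in>gedges G. e \<subseteq> gverts G \<and> card e = 2)"

definition adjacent :: "'a sgraph \<Rightarrow> 'a \<Rightarrow> 'a \<Rightarrow> bool" where
  "adjacent G x y \<longleftrightarrow> {x, y} \<in> gedges G"

definition induced_subgraph :: "'a sgraph \<Rightarrow> 'a set \<Rightarrow> 'a sgraph" where
  "induced_subgraph G W = \<lparr>gverts = gverts G \<inter> W, gedges = {e \<in> gedges G. e \<subseteq> W}\<rparr>"

definition graph_components :: "'a sgraph \<Rightarrow> 'a sgraph set" where
  "graph_components G = {induced_subgraph G {y. (adjacent G)\<^sup>*\<^sup>* x y} | x. x \<in> gverts G}"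

definition cycle_edges :: "'a list \<Rightarrow> 'a set set" where
  "cycle_edges vs = {{vs ! i, vs ! (Suc i mod length vs)} | i. i < length vs}"

definition is_cycle :: "'a sgraph \<Rightarrow> 'a list \<Rightarrow> bool" where
  "is_cycle G vs \<longleftrightarrow> length vs \<ge> 3 \<and> distinct vs \<and> set vs \<subseteq> gverts G \<and> cycle_edges vs \<subseteq> gedges G"

definition perfect_matching :: "'a sgraph \<Rightarrow> 'a set set \<Rightarrow> bool" where
  "perfect_matching G M \<longleftrightarrow> M \<subseteq> gedges G \<and> (\<forall>v\<in>gverts G. \<exists>!e. e \<in> M \<and> v \<in> e)"

definition hypercube :: "nat \<Rightarrow> bool list sgraph" where
  "hypercube n =
    \<lparr>gverts = {a. length a = n},
     gedges = {{a, b} | a b. length a = n \<and> length b = n \<and> card {i. i < n \<and> a ! i \<noteq> b ! i} = 1}\<rparr>"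

definition induced_cubical :: "'a sgraph \<Rightarrow> bool" where
  "induced_cubical H \<longleftrightarrow>
    (\<exists>n\<ge>1. \<exists>l. inj_on l (gverts H) \<and> l ` gverts H \<subseteq> gverts (hypercube n) \<and>
      (\<forall>x\<in>gverts H. \<forall>y\<in>gverts H. adjacent (hypercube n) (l x) (l y) \<longleftrightarrow> adjacent H x y))"

definition closed_surface :: "'p topology \<Rightarrow> bool" where
  "closed_surface X \<longleftrightarrow>
    topspace X \<noteq> {} \<and> compact_space X \<and> connected_space X \<and>
    Hausdorff_space X \<and> second_countable X \<and>
    (\<forall>x\<in>topspace X. \<exists>U. openin X U \<and> x \<in> U \<and>
      subtopology X U homeomorphic_space (euclidean :: (real ^ 2) topology))"

text \<open>The map \<open>p\<close> places the vertices, and \<open>c e\<close>, restricted to \<open>{0..1}\<close>, parametrises the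
  arc of the edge \<open>e\<close>. The orientation of the parametrisation is irrelevant.\<close>

definition graph_embedding ::
  "'v sgraph \<Rightarrow> 'p topology \<Rightarrow> ('v \<Rightarrow> 'p) \<Rightarrow> ('v set \<Rightarrow> real \<Rightarrow> 'p) \<Rightarrow> bool" where
  "graph_embedding G X p c \<longleftrightarrow>
    p ` gverts G \<subseteq> topspace X \<and> inj_on p (gverts G) \<and>
    (\<forall>e\<in>gedges G. pathin X (c e) \<and> inj_on (c e) {0..1} \<and> {c e 0, c e 1} = p ` e \<and>
      c e ` {0..1} \<inter> p ` gverts G = p ` e) \<and>
    (\<forall>e\<in>gedges G. \<forall>e'\<in>gedges G. e \<noteq> e' \<longrightarrow> c e ` {0..1} \<inter> c e' ` {0..1} \<subseteq> p ` (e \<inter> e'))"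

definition graph_points :: "'v sgraph \<Rightarrow> ('v \<Rightarrow> 'p) \<Rightarrow> ('v set \<Rightarrow> real \<Rightarrow> 'p) \<Rightarrow> 'p set" where
  "graph_points G p c = p ` gverts G \<union> (\<Union>e\<in>gedges G. c e ` {0..1})"

definition faces ::
  "'v sgraph \<Rightarrow> 'p topology \<Rightarrow> ('v \<Rightarrow> 'p) \<Rightarrow> ('v set \<Rightarrow> real \<Rightarrow> 'p) \<Rightarrow> 'p set set" where
  "faces G X p c =
    {X closure_of C | C. C \<in> connected_components_of (subtopology X (topspace X - graph_points G p c))}"

text \<open>A face \<open>f\<close> is the closure of a component \<open>C\<close> of the complement of the graph, and
  \<open>C = f - graph_points G p c\<close> (lemma \<open>face_minus_graph\<close>). The boundary of the face is the frontier
  of \<open>C\<close>. The frontier of \<open>f\<close> itself would miss the edges that have \<open>f\<close> on both sides.\<close>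

definition face_boundary ::
  "'v sgraph \<Rightarrow> 'p topology \<Rightarrow> ('v \<Rightarrow> 'p) \<Rightarrow> ('v set \<Rightarrow> real \<Rightarrow> 'p) \<Rightarrow> 'p set \<Rightarrow> 'p set" where
  "face_boundary G X p c f = X frontier_of (f - graph_points G p c)"

lemma face_minus_graph:
  assumes "C \<in> connected_components_of (subtopology X (topspace X - graph_points G p c))"
  shows "X closure_of C - graph_points G p c = C"
proof -
  let ?S = "topspace X - graph_points G p c"
  have "closedin (subtopology X ?S) C"
    using assms by (rule closedin_connected_components_of)
  moreover have "C \<subseteq> ?S"
    using connected_components_of_subset[OF assms] by auto
  ultimately have "?S \<inter> X closure_of C = C"
    by (metis closure_of_closedin closure_of_subtopology inf.absorb_iff2)
  then show ?thesis
    using closure_of_subset_topspace[of X C] by blast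
qed

definition face_edges ::
  "'v sgraph \<Rightarrow> 'p topology \<Rightarrow> ('v \<Rightarrow> 'p) \<Rightarrow> ('v set \<Rightarrow> real \<Rightarrow> 'p) \<Rightarrow> 'p set \<Rightarrow> 'v set set" where
  "face_edges G X p c f = {e \<in> gedges G. c e ` {0..1} \<subseteq> face_boundary G X p c f}"

definition even_face ::
  "'v sgraph \<Rightarrow> 'p topology \<Rightarrow> ('v \<Rightarrow> 'p) \<Rightarrow> ('v set \<Rightarrow> real \<Rightarrow> 'p) \<Rightarrow> 'p set \<Rightarrow> bool" where
  "even_face G X p c f \<longleftrightarrow> f \<in> faces G X p c \<and>
    (\<exists>vs. is_cycle G vs \<and> even (length vs) \<and>
      face_boundary G X p c f = (\<Union>e\<in>cycle_edges vs. c e ` {0..1}))"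

lemma face_edges_eq_cycle_edges:
  assumes emb: "graph_embedding G X p c" and cyc: "is_cycle G vs"
    and bd: "face_boundary G X p c f = (\<Union>e\<in>cycle_edges vs. c e ` {0..1})"
  shows "face_edges G X p c f = cycle_edges vs"
proof
  show "cycle_edges vs \<subseteq> face_edges G X p c f"
    using cyc bd by (auto simp: face_edges_def is_cycle_def)
  show "face_edges G X p c f \<subseteq> cycle_edges vs"
  proof
    fix e assume "e \<in> face_edges G X p c f"
    then have e: "e \<in> gedges G" and sub: "c e ` {0..1} \<subseteq> (\<Union>e\<in>cycle_edges vs. c e ` {0..1})"
      using bd by (auto simp: face_edges_def)
    have half: "c e (1/2) \<in> c e ` {0..1}" by auto
    then obtain e' where e': "e' \<in> cycle_edges vs" "c e (1/2) \<in> c e' ` {0..1}"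
      using sub by blast
    have "e' \<in> gedges G" using e' cyc by (auto simp: is_cycle_def)
    have "e = e'"
    proof (rule ccontr)
      assume "e \<noteq> e'"
      then have "c e (1/2) \<in> p ` (e \<inter> e')"
        using emb e \<open>e' \<in> gedges G\<close> half e'(2) unfolding graph_embedding_def by blast
      then have "c e (1/2) \<in> {c e 0, c e 1}"
        using emb e unfolding graph_embedding_def by blast
      moreover have "inj_on (c e) {0..1}"
        using emb e unfolding graph_embedding_def by blast
      ultimately show False
        by (auto dest: inj_onD)
    qed
    with e' show "e \<in> cycle_edges vs" by simp
  qed
qed

definition resonance_graph ::
  "'v sgraph \<Rightarrow> 'p topology \<Rightarrow> ('v \<Rightarrow> 'p) \<Rightarrow> ('v set \<Rightarrow> real \<Rightarrow> 'p) \<Rightarrow> 'p set set \<Rightarrow> 'v set set sgraph" where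
  "resonance_graph G X p c F =
    \<lparr>gverts = {M. perfect_matching G M},
     gedges = {{M1, M2} | M1 M2. perfect_matching G M1 \<and> perfect_matching G M2 \<and>
       (\<exists>f\<in>F. sym_diff M1 M2 = face_edges G X p c f)}\<rparr>"

end

theory Submission imports Defs "HOL-Complex_Analysis.Contour_Integration"
begin

text \<open>The edge sets \<open>E(f)\<close> of the faces in \<open>F\<close> are linearly independent over \<open>GF(2)\<close>: if every
  edge were on an even number of faces of a nonempty finite \<open>S \<subseteq> F\<close>, then, as an edge has at
  most two sides, both sides of each edge on a face of \<open>S\<close> would belong to \<open>\<Union>S\<close>, so that
  \<open>\<Union>S\<close> would be open and closed in the surface, and \<open>S\<close> would consist of all faces. In a component
  of the resonance graph with base point \<open>M\<^sub>0\<close>, each \<open>M\<^sub>0 \<oplus> M\<close> is thus a sum of a unique set of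
  boundaries \<open>E(f)\<close>, \<open>f \<in> F\<close>, and the indicator vector of this set is the label of \<open>M\<close>.\<close>

subsection \<open>Arcs in the plane\<close>

text \<open>The times at which \<open>d\<close> equals \<open>r\<close> form a compact set, and its
  least element is the wanted time: a value of at least \<open>r\<close> before it would, by the
  intermediate value theorem, produce a still earlier crossing.\<close>

lemma first_crossing:
  fixes d :: "real \<Rightarrow> real"
  assumes "continuous_on {a..b} d" "a \<le> b" "d a < r" "r \<le> d b"
  obtains s where "a < s" "s \<le> b" "d s = r" "\<And>t. a \<le> t \<Longrightarrow> t < s \<Longrightarrow> d t < r"
proof -
  define T where "T = {t \<in> {a..b}. d t = r}"
  have cT: "compact T"
    unfolding T_def
    by (rule closedin_compact[OF compact_Icc continuous_closedin_preimage_constant[OF assms(1)]])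
  have "T \<noteq> {}"
    using IVT'[of d a r b] assms unfolding T_def by force
  then obtain s where s: "s \<in> T" "\<And>t. t \<in> T \<Longrightarrow> s \<le> t"
    using cT compact_attains_inf by metis
  have "d t < r" if t: "a \<le> t" "t < s" for t
  proof (rule ccontr)
    assume "\<not> d t < r"
    then obtain u where "a \<le> u" "u \<le> t" "d u = r"
      using IVT'[of d a r t] assms(1,3) t s(1) continuous_on_subset[of "{a..b}" d "{a..t}"]
      by (force simp: T_def)
    then show False
      using s t by (force simp: T_def)
  qed
  moreover have "a \<noteq> s"
    using s(1) assms(3) by (auto simp: T_def)
  ultimately show thesis
    using that[of s] s(1) by (auto simp: T_def)
qed

text \<open>Time reversal of \<open>first_crossing\<close>.\<close>

lemma last_crossing:
  fixes d :: "real \<Rightarrow> real"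
  assumes "continuous_on {a..b} d" "a \<le> b" "d b < r" "r \<le> d a"
  obtains s where "a \<le> s" "s < b" "d s = r" "\<And>t. s < t \<Longrightarrow> t \<le> b \<Longrightarrow> d t < r"
proof -
  have "continuous_on {-b..-a} (d \<circ> uminus)"
    by (intro continuous_on_compose continuous_intros) (simp add: assms(1))
  then obtain s where s: "-b < s" "s \<le> -a" "(d \<circ> uminus) s = r"
    "\<And>t. -b \<le> t \<Longrightarrow> t < s \<Longrightarrow> (d \<circ> uminus) t < r"
    using first_crossing[of "-b" "-a" "d \<circ> uminus" r] assms by auto
  have "d t < r" if "-s < t" "t \<le> b" for t
    using s(4)[of "-t"] that by auto
  then show thesis
    using that[of "-s"] s(1-3) by auto
qed

text \<open>The ends of \<open>g\<close> cut the circle into two arcs. Each of them forms with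
  \<open>g\<close> a Jordan curve, whose inside is connected, and the two insides fill the disc off
  \<open>g\<close>. The conclusion records only that there are at most two sides.\<close>

lemma crosscut_two_sides:
  fixes g :: "real \<Rightarrow> complex"
  assumes "arc g" "0 < r" "pathstart g \<in> sphere z r" "pathfinish g \<in> sphere z r"
    and inner: "path_image g - {pathstart g, pathfinish g} \<subseteq> ball z r"
  obtains A B where "connected A" "connected B" "ball z r - path_image g = A \<union> B"
proof -
  define a b where "a = pathstart g" and "b = pathfinish g"
  have ab: "a \<noteq> b"
    using arc_distinct_ends[OF \<open>arc g\<close>] by (auto simp: a_def b_def)
  have pig: "path_image (circlepath z r) = sphere z r"
    using \<open>0 < r\<close> by simp
  have sc: "simple_path (circlepath z r)"
    using \<open>0 < r\<close> by (simp add: simple_path_circlepath)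
  obtain u d where ud: "arc u" "arc d" "pathstart u = a" "pathfinish u = b"
      "pathstart d = b" "pathfinish d = a" "path_image u \<inter> path_image d = {a,b}"
      "path_image u \<union> path_image d = sphere z r"
  proof -
    have "pathfinish (circlepath z r) = pathstart (circlepath z r)"
        "a \<in> path_image (circlepath z r)" "b \<in> path_image (circlepath z r)"
      using assms(3,4) unfolding pig a_def b_def by auto
    from exists_double_arc[OF sc this ab] show thesis
      using that unfolding pig by blast
  qed
  \<comment> \<open>\<open>d\<close> runs from \<open>b\<close> back to \<open>a\<close>; after
    reversal all three arcs of the theta curve run from \<open>a\<close> to
    \<open>b\<close>.\<close>
  define d' where "d' = reversepath d"
  have d': "arc d'" "pathstart d' = a" "pathfinish d' = b" "path_image d' = path_image d"
    using ud by (auto simp: d'_def arc_reversepath)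
  have abg: "a \<in> path_image g" "b \<in> path_image g"
    by (auto simp: a_def b_def)
  have ins: "inside (sphere z r) = ball z r"
    using inside_frontier_eq_interior[of "cball z r"] \<open>0 < r\<close> by simp
  have disj: "sphere z r \<inter> path_image g = {a,b}"
    using inner abg assms(3,4) by (auto simp: a_def b_def)
  have ug: "path_image u \<inter> path_image g = {a,b}" and dg: "path_image d' \<inter> path_image g = {a,b}"
    using disj ud(7,8) abg d'(4) by blast+
  \<comment> \<open>Splitting the inside of the circle requires that the third arc enters it; the
    midpoint of \<open>g\<close> is a witness.\<close>
  have meets: "path_image g \<inter> inside (path_image u \<union> path_image d') \<noteq> {}"
  proof -
    have "g (1/2) \<in> path_image g" by (auto simp: path_image_def)
    moreover have "g (1/2) \<noteq> g 0" "g (1/2) \<noteq> g 1"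
      using \<open>arc g\<close> by (auto simp: arc_def dest: inj_onD)
    ultimately have "g (1/2) \<in> ball z r"
      using inner by (auto simp: pathstart_def pathfinish_def)
    then show ?thesis
      using \<open>g (1/2) \<in> path_image g\<close> unfolding d'(4) ud(8) ins by blast
  qed
  have split: "inside (path_image u \<union> path_image g) \<union> inside (path_image d' \<union> path_image g)
      \<union> (path_image g - {a,b}) = ball z r"
  proof (rule split_inside_simple_closed_curve[of u a b d' g])
    show "path_image u \<inter> path_image d' = {a,b}"
      using ud(7) d'(4) by simp
    assume "inside (path_image u \<union> path_image g) \<union> inside (path_image d' \<union> path_image g)
      \<union> (path_image g - {a,b}) = inside (path_image u \<union> path_image d')"
    then show ?thesis
      unfolding d'(4) ud(8) ins .
  qed (use ud(1,3,4) d'(1-3) ab ug dg meets \<open>arc g\<close> in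
      \<open>simp_all add: arc_imp_simple_path a_def[symmetric] b_def[symmetric]\<close>)
  have "connected (inside (path_image h \<union> path_image g))"
    if "arc h" "pathstart h = a" "pathfinish h = b" "path_image h \<inter> path_image g = {a,b}" for h
  proof -
    have "simple_path (h +++ reversepath g)"
      using that \<open>arc g\<close> ab
      by (simp add: simple_path_join_loop_eq arc_reversepath a_def b_def)
    moreover have "path_image (h +++ reversepath g) = path_image h \<union> path_image g"
      using that by (simp add: path_image_join b_def)
    ultimately show ?thesis
      using Jordan_inside_outside[of "h +++ reversepath g"] that by (simp add: a_def)
  qed
  then have "connected (inside (path_image u \<union> path_image g))"
    "connected (inside (path_image d' \<union> path_image g))"
    using ud(1,3,4) d'(1-3) ug dg by blast+
  moreover have "inside (path_image u \<union> path_image g) \<inter> path_image g = {}"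
      "inside (path_image d' \<union> path_image g) \<inter> path_image g = {}"
    using inside_no_overlap by blast+
  moreover have "a \<notin> ball z r" "b \<notin> ball z r"
    using assms(3,4) by (auto simp: a_def b_def)
  ultimately show thesis
    using split
    by (intro that[of "inside (path_image u \<union> path_image g)" "inside (path_image d' \<union> path_image g)"]) blast+
qed

text \<open>Janiszewski's theorem lets us ignore the parts of the arc that re-enter the disc
  after the first exit, since together with the circle they meet the crosscut in a connected set.\<close>

lemma arc_two_local_sides:
  fixes g :: "real \<Rightarrow> complex"
  assumes "arc g" "0 < t" "t < 1" "0 < r"
  obtains \<delta> where "0 < \<delta>" "\<delta> \<le> r"
    "\<And>w1 w2 w3. {w1, w2, w3} \<subseteq> ball (g t) \<delta> - path_image g \<Longrightarrow>
      connected_component (ball (g t) r - path_image g) w1 w2 \<or>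
      connected_component (ball (g t) r - path_image g) w1 w3 \<or>
      connected_component (ball (g t) r - path_image g) w2 w3"
proof -
  define z where "z = g t"
  have cont: "continuous_on {0..1} g" and inj: "inj_on g {0..1}"
    using \<open>arc g\<close> by (auto simp: arc_def path_def)
  have gne: "g s \<noteq> z" if "s \<in> {0..1}" "s \<noteq> t" for s
    using inj_onD[OF inj, of s t] that assms by (auto simp: z_def)
  \<comment> \<open>Both ends of \<open>g\<close> lie outside the open disc of radius
    \<open>\<rho>\<close> about \<open>z\<close>, so the arc leaves this disc both before and after
    time \<open>t\<close>. The exits at \<open>t1\<close> and \<open>t2\<close> bound a crosscut
    \<open>h\<close> through \<open>z\<close>.\<close>
  define \<rho> where "\<rho> = Min {r, dist z (g 0), dist z (g 1)}"
  have \<rho>: "0 < \<rho>" "\<rho> \<le> r" "\<rho> \<le> dist z (g 0)" "\<rho> \<le> dist z (g 1)"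
    using assms gne[of 0] gne[of 1] by (auto simp: \<rho>_def)
  have dc: "continuous_on {0..1} (\<lambda>s. dist z (g s))"
    by (intro continuous_intros cont)
  obtain t2 where t2: "t < t2" "t2 \<le> 1" "dist z (g t2) = \<rho>"
      "\<And>s. t \<le> s \<Longrightarrow> s < t2 \<Longrightarrow> dist z (g s) < \<rho>"
    using first_crossing[of t 1 "\<lambda>s. dist z (g s)" \<rho>] continuous_on_subset[OF dc, of "{t..1}"]
      assms \<rho> by (auto simp: z_def)
  obtain t1 where t1: "0 \<le> t1" "t1 < t" "dist z (g t1) = \<rho>"
      "\<And>s. t1 < s \<Longrightarrow> s \<le> t \<Longrightarrow> dist z (g s) < \<rho>"
    using last_crossing[of 0 t "\<lambda>s. dist z (g s)" \<rho>] continuous_on_subset[OF dc, of "{0..t}"]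
      assms \<rho> by (auto simp: z_def)
  define h where "h = subpath t1 t2 g"
  have h: "arc h" "pathstart h = g t1" "pathfinish h = g t2" "path_image h = g ` {t1..t2}"
    using t1 t2 arc_subpath_arc[OF \<open>arc g\<close>, of t1 t2]
    by (auto simp: h_def path_image_subpath)
  have "path_image h - {pathstart h, pathfinish h} \<subseteq> ball z \<rho>"
  proof
    fix y assume "y \<in> path_image h - {pathstart h, pathfinish h}"
    then obtain s where s: "y = g s" "t1 < s" "s < t2"
      using h by force
    then show "y \<in> ball z \<rho>"
      using t1(4)[of s] t2(4)[of s] by force
  qed
  then obtain A B where AB: "connected A" "connected B" "ball z \<rho> - path_image h = A \<union> B"
    using crosscut_two_sides[of h \<rho> z] h t1 t2 \<rho> by auto
  \<comment> \<open>\<open>K\<close> is the remainder of the arc. It may re-enter the disc, but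
    injectivity keeps \<open>z\<close> out of it, so a small disc about \<open>z\<close> misses
    it.\<close>
  define K where "K = g ` ({0..t1} \<union> {t2..1})"
  have K: "compact K"
    unfolding K_def using t1 t2
    by (intro compact_continuous_image continuous_on_subset[OF cont] compact_Un) auto
  have "z \<notin> K"
    using gne t1 t2 unfolding K_def image_iff
    by (metis Un_iff atLeastAtMost_iff dual_order.trans less_imp_le not_le)
  then obtain \<delta>0 where \<delta>0: "0 < \<delta>0" "ball z \<delta>0 \<subseteq> -K"
    using K compact_imp_closed open_Compl openE by (metis ComplI)
  define \<delta> where "\<delta> = min \<delta>0 \<rho>"
  have pig: "path_image g = path_image h \<union> K"
  proof -
    have "{0..1} = {t1..t2} \<union> ({0..t1} \<union> {t2..1})"
      using t1 t2 by auto
    then show ?thesis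
      unfolding K_def h(4) image_Un[symmetric] by (simp add: path_image_def)
  qed
  have hK: "path_image h \<inter> K \<subseteq> sphere z \<rho>"
  proof
    fix y assume "y \<in> path_image h \<inter> K"
    then obtain s s' where s: "s \<in> {t1..t2}" "s' \<in> {0..t1} \<union> {t2..1}" "g s = y" "g s' = y"
      unfolding h(4) K_def by (metis IntE imageE)
    then have "s = s'"
      using inj_onD[OF inj, of s s'] t1 t2 by auto
    show "y \<in> sphere z \<rho>"
    proof -
      have "s = t1 \<or> s = t2"
        using \<open>s = s'\<close> s(1,2) by auto
      then show ?thesis
        using s(3) t1(3) t2(3) by auto
    qed
  qed
  have join: "connected_component (ball z r - path_image g) w w'"
    if w: "w \<in> ball z \<delta>" "w' \<in> ball z \<delta>" and C: "connected C" "C \<subseteq> ball z \<rho> - path_image h" "w \<in> C" "w' \<in> C"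
    for w w' C
  proof -
    \<comment> \<open>The points are joined off the crosscut and circle through \<open>C\<close>,
      and off \<open>K\<close> and the circle through the small disc. As \<open>h\<close> and
      \<open>K\<close> meet only on the circle, the two obstacles intersect exactly in the circle,
      which is connected.\<close>
    have "connected_component (- ((path_image h \<union> sphere z \<rho>) \<union> (K \<union> sphere z \<rho>))) w w'"
    proof (rule Janiszewski)
      show "compact (path_image h \<union> sphere z \<rho>)" "closed (K \<union> sphere z \<rho>)"
        using compact_arc_image[OF h(1)] K
        by (simp_all add: compact_Un closed_Un compact_imp_closed)
      have "(path_image h \<union> sphere z \<rho>) \<inter> (K \<union> sphere z \<rho>) = sphere z \<rho>"
        using hK by blast
      then show "connected ((path_image h \<union> sphere z \<rho>) \<inter> (K \<union> sphere z \<rho>))"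
        by (simp add: connected_sphere DIM_complex)
      show "connected_component (- (path_image h \<union> sphere z \<rho>)) w w'"
        unfolding connected_component_def using C by (intro exI[of _ C]) auto
      show "connected_component (- (K \<union> sphere z \<rho>)) w w'"
        unfolding connected_component_def using w \<delta>0 by (intro exI[of _ "ball z \<delta>"]) (auto simp: \<delta>_def)
    qed
    then obtain D where D: "connected D" "w \<in> D" "w' \<in> D" "D \<inter> path_image g = {}" "D \<inter> sphere z \<rho> = {}"
      unfolding connected_component_def pig by blast
    \<comment> \<open>A connected set that meets the disc and avoids its bounding circle cannot
      leave it.\<close>
    have "D \<subseteq> ball z \<rho>"
    proof (rule ccontr)
      assume "\<not> D \<subseteq> ball z \<rho>"
      moreover have "w \<in> D \<inter> ball z \<rho>"
        using D(2) w(1) by (simp add: \<delta>_def)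
      ultimately have "D \<inter> frontier (ball z \<rho>) \<noteq> {}"
        by (intro connected_Int_frontier[OF \<open>connected D\<close>]) blast+
      then show False using D \<rho> by simp
    qed
    then show ?thesis
      unfolding connected_component_def using D \<rho> by (intro exI[of _ D]) auto
  qed
  show thesis
  proof
    show "0 < \<delta>" "\<delta> \<le> r"
      using \<delta>0 \<rho> by (auto simp: \<delta>_def)
    fix w1 w2 w3 assume w: "{w1, w2, w3} \<subseteq> ball (g t) \<delta> - path_image g"
    have *: "{w1, w2, w3} \<subseteq> ball z \<delta>"
      using w unfolding z_def by blast
    have "ball z \<delta> - path_image g \<subseteq> ball z \<rho> - path_image h"
      unfolding pig by (auto simp: \<delta>_def)
    then have **: "{w1, w2, w3} \<subseteq> A \<union> B"
      using w unfolding AB(3) z_def[symmetric] by blast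
    have sub: "A \<subseteq> ball z \<rho> - path_image h" "B \<subseteq> ball z \<rho> - path_image h"
      unfolding AB(3) by auto
    show "connected_component (ball (g t) r - path_image g) w1 w2 \<or>
      connected_component (ball (g t) r - path_image g) w1 w3 \<or>
      connected_component (ball (g t) r - path_image g) w2 w3"
    proof -
      have "(w1 \<in> A \<and> w2 \<in> A \<or> w1 \<in> B \<and> w2 \<in> B) \<or> (w1 \<in> A \<and> w3 \<in> A \<or> w1 \<in> B \<and> w3 \<in> B)
          \<or> (w2 \<in> A \<and> w3 \<in> A \<or> w2 \<in> B \<and> w3 \<in> B)"
        using ** by blast
      moreover have "connected_component (ball z r - path_image g) w w'"
        if "w \<in> A \<and> w' \<in> A \<or> w \<in> B \<and> w' \<in> B" "w \<in> ball z \<delta>" "w' \<in> ball z \<delta>" for w w'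
        using that(1) join[OF that(2,3) AB(1) sub(1)] join[OF that(2,3) AB(2) sub(2)] by argo
      ultimately show ?thesis
        using * unfolding z_def[symmetric] insert_subset by metis
    qed
  qed
qed

subsection \<open>Charts and edges\<close>

text \<open>The model plane is \<open>complex\<close>, where the lemmas on arcs are stated. As
  \<open>k\<close> is defined on the whole plane, subsets of the surface are pulled back by plain
  preimages.\<close>

locale plane_chart =
  fixes X :: "'p topology" and U :: "'p set" and k :: "complex \<Rightarrow> 'p" and k' :: "'p \<Rightarrow> complex"
  assumes open_dom: "openin X U"
    and homeo: "homeomorphic_maps euclidean (subtopology X U) k k'"
begin

lemma k_in: "k w \<in> U"
  using homeo by (auto simp: homeomorphic_maps_def continuous_map_def)

lemma k'_k: "k' (k w) = w"
  using homeo by (simp add: homeomorphic_maps_def)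

lemma k_k': "x \<in> U \<Longrightarrow> k (k' x) = x"
  using homeo openin_subset[OF open_dom] by (auto simp: homeomorphic_maps_def)

lemma inj_k: "inj k"
  by (metis injI k'_k)

lemma cont_k: "continuous_map euclidean X k"
  using homeo by (auto simp: homeomorphic_maps_def continuous_map_in_subtopology)

lemma cont_k': "continuous_map (subtopology X U) euclidean k'"
  using homeo by (simp add: homeomorphic_maps_def)

lemma open_image:
  assumes "open S" shows "openin X (k ` S)"
proof -
  have "open_map euclidean (subtopology X U) k"
    using homeo by (simp add: homeomorphic_maps_map homeomorphic_imp_open_map)
  then have "openin (subtopology X U) (k ` S)"
    using assms by (simp add: open_map_def)
  then show ?thesis
    by (simp add: openin_open_subtopology[OF open_dom])
qed

lemma open_preimage: "openin X S \<Longrightarrow> open (k -` S)"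
  using openin_continuous_map_preimage[OF cont_k] by (auto simp: vimage_def)

lemma closed_preimage: "closedin X S \<Longrightarrow> closed (k -` S)"
  using closedin_continuous_map_preimage[OF cont_k] by (auto simp: vimage_def)

lemma connected_image: "connected S \<Longrightarrow> connectedin X (k ` S)"
  using connectedin_continuous_map_image[OF cont_k] by simp

end

lemma closed_surface_chart:
  assumes "closed_surface X" "x \<in> topspace X"
  obtains U k k' where "plane_chart X U k k'" "x \<in> U"
proof -
  obtain U where U: "openin X U" "x \<in> U"
      "subtopology X U homeomorphic_space (euclidean :: (real ^ 2) topology)"
    using assms unfolding closed_surface_def by blast
  have "(UNIV :: complex set) homeomorphic (UNIV :: (real ^ 2) set)"
    by (simp add: homeomorphic_UNIV_UNIV)
  then have "(euclidean :: complex topology) homeomorphic_space (euclidean :: (real ^ 2) topology)"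
    by (auto simp: homeomorphic_def homeomorphism_def homeomorphic_space_def homeomorphic_maps_def)
  then have "(euclidean :: complex topology) homeomorphic_space subtopology X U"
    using U(3) homeomorphic_space_sym homeomorphic_space_trans by blast
  then show thesis
    using that U by (auto simp: homeomorphic_space_def plane_chart_def)
qed

section \<open>Closedness of the embedded graph and points inside an edge\<close>

lemma closedin_arc:
  assumes "Hausdorff_space X" "pathin X \<gamma>" "compact T" "T \<subseteq> {0..1}"
  shows "closedin X (\<gamma> ` T)"
proof (rule compactin_imp_closedin[OF assms(1)], rule image_compactin)
  show "compactin (top_of_set {0..1}) T"
    using assms by (simp add: compactin_subtopology)
  show "continuous_map (top_of_set {0..1}) X \<gamma>"
    using assms by (simp add: pathin_def)
qed

lemma closedin_finite_points:
  assumes "Hausdorff_space X" "finite P" "P \<subseteq> topspace X"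
  shows "closedin X P"
  using compactin_imp_closedin[OF assms(1) finite_imp_compactin[OF assms(3,2)]] .

lemma closedin_graph_points:
  assumes "Hausdorff_space X" "graph_embedding G X p c" "finite (gverts G)" "finite (gedges G)"
  shows "closedin X (graph_points G p c)"
proof -
  have "closedin X (p ` gverts G)"
    using assms by (intro closedin_finite_points) (auto simp: graph_embedding_def)
  moreover have "closedin X (\<Union>e\<in>gedges G. c e ` {0..1})"
    using assms by (intro closedin_Union) (auto simp: graph_embedding_def intro!: closedin_arc)
  ultimately show ?thesis
    unfolding graph_points_def by (rule closedin_Un)
qed

text \<open>The arc of \<open>e\<close> can meet vertices and other edges only in the images of its
  own ends, and injectivity keeps an interior parameter away from these.\<close>

lemma edge_interior_point:
  assumes emb: "graph_embedding G X p c" and e: "e \<in> gedges G" and s: "0 < s" "s < 1"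
  shows "c e s \<notin> p ` gverts G" "e' \<in> gedges G \<Longrightarrow> e' \<noteq> e \<Longrightarrow> c e s \<notin> c e' ` {0..1}"
proof -
  have *: "inj_on (c e) {0..1}" "{c e 0, c e 1} = p ` e" "c e ` {0..1} \<inter> p ` gverts G = p ` e"
    using emb e by (auto simp: graph_embedding_def)
  have in1: "c e s \<in> c e ` {0..1}"
    using s by simp
  have "c e s \<noteq> c e 0" "c e s \<noteq> c e 1"
    using inj_onD[OF *(1), of s 0] inj_onD[OF *(1), of s 1] s by auto
  then have ne: "c e s \<notin> p ` e"
    using *(2) by blast
  then show "c e s \<notin> p ` gverts G"
    using *(3) in1 by blast
  assume "e' \<in> gedges G" "e' \<noteq> e"
  then have "c e ` {0..1} \<inter> c e' ` {0..1} \<subseteq> p ` (e \<inter> e')"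
    using emb e unfolding graph_embedding_def by metis
  then show "c e s \<notin> c e' ` {0..1}"
    using ne in1 by blast
qed

text \<open>That two of any three nearby points off the graph can be joined off it expresses that an
  edge has at most two sides. Near an interior point of an edge the graph is just a subarc of this
  edge, which the chart carries to a plane arc, so that \<open>arc_two_local_sides\<close>
  applies.\<close>

lemma (in plane_chart) edge_two_local_sides:
  assumes emb: "graph_embedding G X p c" and fin: "finite (gverts G)" "finite (gedges G)"
    and H: "Hausdorff_space X" and e: "e \<in> gedges G" and t: "0 < t" "t < 1" and z: "k z = c e t"
  obtains \<delta> where "0 < \<delta>" "k ` ball z \<delta> \<inter> graph_points G p c \<subseteq> c e ` {0..1}"
    "\<And>w1 w2 w3. {w1, w2, w3} \<subseteq> ball z \<delta> - k -` graph_points G p c \<Longrightarrow>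
      connected_component (- (k -` graph_points G p c)) w1 w2 \<or>
      connected_component (- (k -` graph_points G p c)) w1 w3 \<or>
      connected_component (- (k -` graph_points G p c)) w2 w3"
proof -
  let ?\<Gamma> = "graph_points G p c"
  have pe: "pathin X (c e)" and inj: "inj_on (c e) {0..1}"
    using emb e by (auto simp: graph_embedding_def)
  then have ce: "continuous_map (top_of_set {0..1}) X (c e)"
    by (simp add: pathin_def)
  have "openin (top_of_set {0..1}) {s \<in> {0..1}. c e s \<in> U}"
    using openin_continuous_map_preimage[OF ce open_dom] by simp
  moreover have "t \<in> {s \<in> {0..1}. c e s \<in> U}"
    using t k_in[of z] z by simp
  ultimately obtain \<epsilon> where \<epsilon>: "0 < \<epsilon>" "ball t \<epsilon> \<inter> {0..1} \<subseteq> {s \<in> {0..1}. c e s \<in> U}"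
    unfolding openin_contains_ball by blast
  \<comment> \<open>Halving \<open>\<epsilon>\<close> keeps the closed interval inside the open ball
    about \<open>t\<close>; the terms \<open>t/2\<close> and \<open>(t+1)/2\<close> keep it strictly
    between 0 and 1.\<close>
  define a b where "a = max (t - \<epsilon>/2) (t/2)" and "b = min (t + \<epsilon>/2) ((t+1)/2)"
  have ab: "0 < a" "a < t" "t < b" "b < 1"
    using t \<epsilon>(1) by (auto simp: a_def b_def min_less_iff_disj)
  have abU: "c e s \<in> U" if "s \<in> {a..b}" for s
  proof -
    have "s \<in> ball t \<epsilon> \<inter> {0..1}"
      using that ab \<epsilon>(1) by (auto simp: a_def b_def dist_real_def)
    then show ?thesis using \<epsilon>(2) by blast
  qed
  define g where "g = subpath a b (k' \<circ> c e)"
  have "continuous_map (top_of_set {a..b}) (subtopology X U) (c e)"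
    using continuous_map_from_subtopology_mono[OF ce, of "{a..b}"] ab abU
    by (auto simp: continuous_map_in_subtopology)
  then have "continuous_map (top_of_set {a..b}) euclidean (k' \<circ> c e)"
    using cont_k' continuous_map_compose by blast
  then have contq: "continuous_on {a..b} (k' \<circ> c e)"
    by simp
  have g_eq: "g s = k' (c e ((b - a) * s + a))" for s
    by (simp add: g_def subpath_def)
  have mem: "(b - a) * s + a \<in> {a..b}" if "s \<in> {0..1}" for s
  proof -
    have "0 \<le> (b - a) * s" "(b - a) * s \<le> (b - a) * 1"
      using that ab by (auto intro!: mult_left_mono mult_nonneg_nonneg)
    then show ?thesis by auto
  qed
  have pig: "path_image g = k' ` c e ` {a..b}"
    using ab unfolding g_def by (simp add: path_image_subpath image_comp)
  have "continuous_on {0..1} g"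
  proof -
    have "continuous_on {0..1} ((k' \<circ> c e) \<circ> (\<lambda>s. (b - a) * s + a))"
    proof (rule continuous_on_compose)
      show "continuous_on ((\<lambda>s. (b - a) * s + a) ` {0..1}) (k' \<circ> c e)"
        using mem by (intro continuous_on_subset[OF contq] image_subsetI)
    qed (intro continuous_intros)
    then show ?thesis
      unfolding g_def subpath_def by (simp add: o_def)
  qed
  moreover have "inj_on g {0..1}"
  proof (rule inj_onI)
    fix s s' assume s: "s \<in> {0..1}" "s' \<in> {0..1}" "g s = g s'"
    let ?u = "(b - a) * s + a" and ?u' = "(b - a) * s' + a"
    have u: "?u \<in> {a..b}" "?u' \<in> {a..b}"
      using mem s by blast+
    have "c e ?u = c e ?u'"
      using s(3) k_k'[OF abU[OF u(1)]] k_k'[OF abU[OF u(2)]] unfolding g_eq by metis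
    then have "?u = ?u'"
      using inj_onD[OF inj, of ?u ?u'] u ab by auto
    then show "s = s'" using ab by simp
  qed
  ultimately have "arc g"
    by (simp add: arc_def path_def)
  \<comment> \<open>The parameter at which the rescaled subarc passes through the point with edge
    parameter \<open>t\<close>.\<close>
  define \<tau> where "\<tau> = (t - a) / (b - a)"
  have \<tau>: "0 < \<tau>" "\<tau> < 1" "g \<tau> = z"
    using ab k'_k[of z] z by (auto simp: \<tau>_def g_eq)
  \<comment> \<open>A closed set that misses \<open>c e t\<close> and makes up the whole graph
    together with the subarc over \<open>{a..b}\<close>.\<close>
  define R where "R = p ` gverts G \<union> (\<Union>e'\<in>gedges G - {e}. c e' ` {0..1}) \<union> c e ` ({0..a} \<union> {b..1})"
  have "closedin X R"
    unfolding R_def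
  proof (intro closedin_Un)
    show "closedin X (p ` gverts G)"
      using fin emb H by (intro closedin_finite_points) (auto simp: graph_embedding_def)
    show "closedin X (\<Union>e'\<in>gedges G - {e}. c e' ` {0..1})"
      using fin emb H by (intro closedin_Union) (auto simp: graph_embedding_def intro!: closedin_arc)
    show "closedin X (c e ` ({0..a} \<union> {b..1}))"
      using ab by (intro closedin_arc H pe compact_Un) auto
  qed
  have "c e t \<notin> c e ` ({0..a} \<union> {b..1})"
  proof
    assume "c e t \<in> c e ` ({0..a} \<union> {b..1})"
    then obtain s where s: "s \<in> {0..a} \<union> {b..1}" "c e t = c e s" by blast
    then have "t = s"
      using ab by (intro inj_onD[OF inj]) auto
    then show False using s(1) ab by auto
  qed
  then have "z \<notin> k -` R"
    using edge_interior_point[OF emb e t] z by (auto simp: R_def)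
  moreover have "open (- (k -` R))"
    using closed_preimage[OF \<open>closedin X R\<close>] by (simp add: open_Compl)
  ultimately obtain r where r: "0 < r" "ball z r \<subseteq> - (k -` R)"
    using openE by blast
  have split_ce: "c e ` {0..1} = c e ` {a..b} \<union> c e ` ({0..a} \<union> {b..1})"
  proof -
    have "{0..1} = {a..b} \<union> ({0..a} \<union> {b..1})" using ab by auto
    then show ?thesis by (metis image_Un)
  qed
  have \<Gamma>: "?\<Gamma> = R \<union> c e ` {a..b}"
  proof -
    have "gedges G = insert e (gedges G - {e})" using e by blast
    then have "(\<Union>e'\<in>gedges G. c e' ` {0..1}) = c e ` {0..1} \<union> (\<Union>e'\<in>gedges G - {e}. c e' ` {0..1})"
      by (metis UN_insert)
    then show ?thesis
      unfolding graph_points_def R_def split_ce by (simp add: Un_ac)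
  qed
  \<comment> \<open>In a disc that misses \<open>R\<close>, avoiding \<open>g\<close> is enough to
    avoid the graph.\<close>
  have sub: "ball z r - path_image g \<subseteq> - (k -` ?\<Gamma>)"
  proof
    fix w assume w: "w \<in> ball z r - path_image g"
    then have "k w \<notin> R" using r by blast
    moreover have "k w \<notin> c e ` {a..b}"
      using w k'_k[of w] unfolding pig by (metis DiffD2 imageI)
    ultimately show "w \<in> - (k -` ?\<Gamma>)" unfolding \<Gamma> by blast
  qed
  have pi_sub: "path_image g \<subseteq> k -` ?\<Gamma>"
  proof
    fix w assume "w \<in> path_image g"
    then obtain s where s: "s \<in> {a..b}" "w = k' (c e s)" unfolding pig by blast
    then have "k w = c e s" using k_k'[OF abU] by simp
    then show "w \<in> k -` ?\<Gamma>" using s(1) unfolding \<Gamma> by blast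
  qed
  obtain \<delta> where \<delta>: "0 < \<delta>" "\<delta> \<le> r"
    "\<And>w1 w2 w3. {w1, w2, w3} \<subseteq> ball z \<delta> - path_image g \<Longrightarrow>
      connected_component (ball z r - path_image g) w1 w2 \<or>
      connected_component (ball z r - path_image g) w1 w3 \<or>
      connected_component (ball z r - path_image g) w2 w3"
    using arc_two_local_sides[OF \<open>arc g\<close> \<tau>(1,2) r(1)] unfolding \<tau>(3) by metis
  show thesis
  proof
    show "0 < \<delta>" by fact
    have "k ` ball z \<delta> \<inter> R = {}"
      using r(2) \<delta>(2) subset_ball[of \<delta> r z] by blast
    then show "k ` ball z \<delta> \<inter> ?\<Gamma> \<subseteq> c e ` {0..1}"
      unfolding \<Gamma> split_ce by blast
    fix w1 w2 w3 assume "{w1, w2, w3} \<subseteq> ball z \<delta> - k -` ?\<Gamma>"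
    then have "{w1, w2, w3} \<subseteq> ball z \<delta> - path_image g"
      using pi_sub by blast
    from \<delta>(3)[OF this] show "connected_component (- (k -` ?\<Gamma>)) w1 w2 \<or>
      connected_component (- (k -` ?\<Gamma>)) w1 w3 \<or>
      connected_component (- (k -` ?\<Gamma>)) w2 w3"
      using connected_component_of_subset[OF _ sub] by blast
  qed
qed

subsection \<open>Independence of face boundaries\<close>

text \<open>Passing to the closure loses nothing: removing the graph recovers the component, so
  facts about components carry over to faces.\<close>

lemma face_component:
  assumes "f \<in> faces G X p c"
  shows "f - graph_points G p c \<in> connected_components_of (subtopology X (topspace X - graph_points G p c))"
    and "X closure_of (f - graph_points G p c) = f"
proof -
  obtain C where C: "C \<in> connected_components_of (subtopology X (topspace X - graph_points G p c))"
      "f = X closure_of C"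
    using assms unfolding faces_def by blast
  show "f - graph_points G p c \<in> connected_components_of (subtopology X (topspace X - graph_points G p c))"
      "X closure_of (f - graph_points G p c) = f"
    using C(1) unfolding C(2) face_minus_graph[OF C(1)] by auto
qed

text \<open>Different faces may share points of the graph. Off the graph a common point makes the
  two components overlap, hence coincide, and a component determines its face.\<close>

lemma faces_eqI:
  assumes "f \<in> faces G X p c" "f' \<in> faces G X p c" "x \<in> f" "x \<in> f'" "x \<notin> graph_points G p c"
  shows "f = f'"
proof -
  have "(f - graph_points G p c) \<inter> (f' - graph_points G p c) \<noteq> {}"
    using assms(3-5) by blast
  then have "f - graph_points G p c = f' - graph_points G p c"
    using connected_components_of_overlap[OF face_component(1)[OF assms(1)] face_component(1)[OF assms(2)]]
    by blast
  then show ?thesis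
    using face_component(2)[OF assms(1)] face_component(2)[OF assms(2)] by metis
qed

lemma closedin_face:
  assumes "f \<in> faces G X p c"
  shows "closedin X f"
  using closedin_closure_of[of X "f - graph_points G p c"] unfolding face_component(2)[OF assms] .

lemma face_not_subset_graph:
  assumes "f \<in> faces G X p c"
  obtains y where "y \<in> f" "y \<notin> graph_points G p c"
proof -
  have "f - graph_points G p c \<noteq> {}"
    using nonempty_connected_components_of[OF face_component(1)[OF assms]] .
  then show thesis using that by blast
qed

text \<open>This is the maximality of a connected component.\<close>

lemma face_contains_connected:
  assumes "f \<in> faces G X p c" "connectedin X C" "C \<inter> graph_points G p c = {}" "x \<in> f" "x \<in> C"
  shows "C \<subseteq> f"
proof -
  have "connectedin (subtopology X (topspace X - graph_points G p c)) C"
    using assms(2,3) connectedin_subset_topspace[OF assms(2)] by (auto simp: connectedin_subtopology)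
  moreover have "\<not> disjnt (f - graph_points G p c) C"
    using assms(3-5) by (auto simp: disjnt_def)
  ultimately show ?thesis
    using connected_components_of_maximal[OF face_component(1)[OF assms(1)]] by blast
qed

text \<open>Such a point is in the closure of the component, but not in the component itself and so
  not in its interior.\<close>

lemma face_graph_point_in_boundary:
  assumes "f \<in> faces G X p c" "x \<in> f" "x \<in> graph_points G p c"
  shows "x \<in> face_boundary G X p c f"
  unfolding face_boundary_def frontier_of_def face_component(2)[OF assms(1)]
  using assms(2,3) interior_of_subset[of X "f - graph_points G p c"] by blast

text \<open>The two-sidedness of edges only gives openness of \<open>\<Union>S\<close> off the vertices; since a finite set
  does not separate the plane, \<open>\<Union>S\<close> then contains a whole chart around each vertex in it.\<close>

lemma even_faces_independent:
  assumes G: "simple_graph G" "finite (gverts G)" and X: "closed_surface X"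
    and emb: "graph_embedding G X p c"
    and S: "finite S" "S \<noteq> {}" "\<forall>f\<in>S. even_face G X p c f"
    and f0: "f0 \<in> faces G X p c" "f0 \<notin> S"
  shows "\<exists>e. odd (card {f \<in> S. e \<in> face_edges G X p c f})"
proof (rule ccontr)
  assume "\<not> ?thesis"
  then have even: "even (card {f \<in> S. e \<in> face_edges G X p c f})" for e
    by blast
  let ?\<Gamma> = "graph_points G p c"
  have H: "Hausdorff_space X"
    using X by (simp add: closed_surface_def)
  have finE: "finite (gedges G)"
    using G finite_subset[of "gedges G" "Pow (gverts G)"] by (auto simp: simple_graph_def)
  have cl\<Gamma>: "closedin X ?\<Gamma>"
    using closedin_graph_points[OF H emb G(2) finE] .
  have SF: "f \<in> faces G X p c" if "f \<in> S" for f
    using S(3) that by (auto simp: even_face_def)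
  have clU: "closedin X (\<Union>S)"
    using S(1) closedin_face[OF SF] by (rule closedin_Union)
  have top: "x \<in> topspace X" if "x \<in> \<Union>S" for x
    using closedin_subset[OF clU] that by blast
  have off_vertices: "\<exists>N. openin X N \<and> x \<in> N \<and> N \<subseteq> \<Union>S" if x: "x \<in> \<Union>S" "x \<notin> p ` gverts G" for x
  proof -
    obtain f where f: "f \<in> S" "x \<in> f" using x by blast
    obtain U k k' where ch: "plane_chart X U k k'" "x \<in> U"
      using closed_surface_chart[OF X top[OF x(1)]] .
    interpret plane_chart X U k k' by fact
    define z where "z = k' x"
    have kz: "k z = x" by (simp add: z_def k_k' ch(2))
    show ?thesis
    proof (cases "x \<in> ?\<Gamma>")
      case False
      have "open (- (k -` ?\<Gamma>))"
        using closed_preimage[OF cl\<Gamma>] by (simp add: open_Compl)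
      then obtain r where r: "0 < r" "ball z r \<subseteq> - (k -` ?\<Gamma>)"
        using False kz openE[of "- (k -` ?\<Gamma>)" z] by auto
      have xk: "x \<in> k ` ball z r"
        using r(1) kz by force
      have "k ` ball z r \<subseteq> f"
        using r(2) by (intro face_contains_connected[OF SF[OF f(1)] _ _ f(2) xk] connected_image) auto
      then show ?thesis
        using xk open_image[OF open_ball[of z r]] f(1) by blast
    next
      case True
      obtain vs where vs: "is_cycle G vs" "face_boundary G X p c f = (\<Union>e\<in>cycle_edges vs. c e ` {0..1})"
        using S(3) f(1) by (auto simp: even_face_def)
      have "x \<in> face_boundary G X p c f"
        using face_graph_point_in_boundary[OF SF[OF f(1)] f(2) True] .
      then obtain e where "e \<in> cycle_edges vs" "x \<in> c e ` {0..1}"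
        using vs(2) by blast
      then have ef: "e \<in> face_edges G X p c f"
        using face_edges_eq_cycle_edges[OF emb vs] by blast
      then have e: "e \<in> gedges G" by (simp add: face_edges_def)
      obtain t where t: "t \<in> {0..1}" "x = c e t"
        using \<open>x \<in> c e ` {0..1}\<close> by blast
      have ends: "{c e 0, c e 1} = p ` e" "e \<subseteq> gverts G"
        using emb e G(1) by (auto simp: graph_embedding_def simple_graph_def)
      then have "t \<noteq> 0" "t \<noteq> 1"
        using x(2) t(2) by blast+
      then have t01: "0 < t" "t < 1"
        using t(1) by auto
      \<comment> \<open>Parity enters here: \<open>f\<close> is counted and the count is even, so a
        second face of \<open>S\<close> has \<open>e\<close> on its boundary.\<close>
      have "card {f \<in> S. e \<in> face_edges G X p c f} \<noteq> 1"
        using even[of e] by (metis odd_one)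
      then have "{f \<in> S. e \<in> face_edges G X p c f} \<noteq> {f}"
        by (metis is_singletonI is_singleton_altdef)
      then obtain f' where f': "f' \<in> S" "e \<in> face_edges G X p c f'" "f' \<noteq> f"
        using f(1) ef by blast
      have ce_sub: "c e ` {0..1} \<subseteq> h" if "h \<in> S" "e \<in> face_edges G X p c h" for h
      proof -
        have "c e ` {0..1} \<subseteq> X closure_of (h - ?\<Gamma>)"
          using that(2) by (auto simp: face_edges_def face_boundary_def frontier_of_def)
        then show ?thesis
          using face_component(2)[OF SF[OF that(1)]] by simp
      qed
      obtain \<delta> where \<delta>: "0 < \<delta>" "k ` ball z \<delta> \<inter> ?\<Gamma> \<subseteq> c e ` {0..1}"
        "\<And>w1 w2 w3. {w1, w2, w3} \<subseteq> ball z \<delta> - k -` ?\<Gamma> \<Longrightarrow>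
          connected_component (- (k -` ?\<Gamma>)) w1 w2 \<or>
          connected_component (- (k -` ?\<Gamma>)) w1 w3 \<or>
          connected_component (- (k -` ?\<Gamma>)) w2 w3"
        using edge_two_local_sides[OF emb G(2) finE H e t01 kz[unfolded t(2)]] by blast
      have xk: "x \<in> k ` ball z \<delta>"
        using \<delta>(1) kz by force
      have opN: "openin X (k ` ball z \<delta>)"
        by (rule open_image[OF open_ball])
      have near: "\<exists>w \<in> ball z \<delta> - k -` ?\<Gamma>. k w \<in> h" if "h \<in> S" "e \<in> face_edges G X p c h" for h
      proof -
        have "x \<in> X closure_of (h - ?\<Gamma>)"
          using ce_sub[OF that] \<open>x \<in> c e ` {0..1}\<close> face_component(2)[OF SF[OF that(1)]] by auto
        then obtain y where "y \<in> h - ?\<Gamma>" "y \<in> k ` ball z \<delta>"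
          using opN xk unfolding in_closure_of by blast
        then show ?thesis by blast
      qed
      obtain w1 where w1: "w1 \<in> ball z \<delta> - k -` ?\<Gamma>" "k w1 \<in> f"
        using near[OF f(1) ef] by blast
      obtain w2 where w2: "w2 \<in> ball z \<delta> - k -` ?\<Gamma>" "k w2 \<in> f'"
        using near[OF f'(1,2)] by blast
      have same: "k w' \<in> h" if h: "h \<in> S" and cc: "connected_component (- (k -` ?\<Gamma>)) w w'" and "k w \<in> h" for w w' h
      proof -
        obtain D where D: "connected D" "D \<subseteq> - (k -` ?\<Gamma>)" "w \<in> D" "w' \<in> D"
          using cc unfolding connected_component_def by blast
        have "k ` D \<subseteq> h"
          using D by (intro face_contains_connected[OF SF[OF h] connected_image[OF D(1)] _ \<open>k w \<in> h\<close>]) auto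
        then show ?thesis using D(4) by blast
      qed
      have "k w \<in> \<Union>S" if w: "w \<in> ball z \<delta>" for w
      proof (cases "k w \<in> ?\<Gamma>")
        case True
        then have "k w \<in> c e ` {0..1}" using \<delta>(2) w by blast
        then show ?thesis using ce_sub[OF f(1) ef] f(1) by blast
      next
        case False
        \<comment> \<open>Since \<open>w1\<close> and \<open>w2\<close> lie in different faces, they
          represent the two sides of \<open>e\<close>; any third point near \<open>z\<close> off the
          graph is joined to one of them and so lies in \<open>f\<close> or
          \<open>f'\<close>.\<close>
        have "\<not> connected_component (- (k -` ?\<Gamma>)) w1 w2"
        proof
          assume "connected_component (- (k -` ?\<Gamma>)) w1 w2"
          then have "k w2 \<in> f" using same[OF f(1) _ w1(2)] by blast
          then have "f = f'"
            using faces_eqI[OF SF[OF f(1)] SF[OF f'(1)] _ w2(2)] w2(1) by blast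
          then show False using f'(3) by simp
        qed
        moreover have "{w1, w2, w} \<subseteq> ball z \<delta> - k -` ?\<Gamma>"
          using w1(1) w2(1) w False by simp
        ultimately have "connected_component (- (k -` ?\<Gamma>)) w1 w \<or> connected_component (- (k -` ?\<Gamma>)) w2 w"
          using \<delta>(3) by blast
        then show ?thesis
          using same[OF f(1) _ w1(2)] same[OF f'(1) _ w2(2)] f(1) f'(1) by blast
      qed
      then show ?thesis
        using xk opN by blast
    qed
  qed
  have at_vertices: "\<exists>N. openin X N \<and> x \<in> N \<and> N \<subseteq> \<Union>S" if x: "x \<in> \<Union>S" for x
  proof -
    obtain f where f: "f \<in> S" "x \<in> f" using x by blast
    obtain U k k' where ch: "plane_chart X U k k'" "x \<in> U"
      using closed_surface_chart[OF X top[OF x]] .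
    interpret plane_chart X U k k' by fact
    define P where "P = k -` (p ` gverts G)"
    have finP: "finite P"
      unfolding P_def using G(2) by (intro finite_vimageI inj_k) simp
    have con: "connected (- P)"
      using connected_open_delete_finite[of UNIV P] finP
      by (simp add: Compl_eq_Diff_UNIV DIM_complex connected_UNIV)
    have clK: "closed (k -` (\<Union>S))"
      by (rule closed_preimage[OF clU])
    have "openin (top_of_set (- P)) (k -` (\<Union>S) \<inter> - P)"
    proof (subst openin_subopen, intro ballI)
      fix w assume w: "w \<in> k -` (\<Union>S) \<inter> - P"
      then obtain N where N: "openin X N" "k w \<in> N" "N \<subseteq> \<Union>S"
        using off_vertices[of "k w"] by (auto simp: P_def)
      then have "openin (top_of_set (- P)) (k -` N \<inter> - P)"
        using open_preimage[OF N(1)] by (auto simp: openin_open)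
      then show "\<exists>T. openin (top_of_set (- P)) T \<and> w \<in> T \<and> T \<subseteq> k -` (\<Union>S) \<inter> - P"
        using w N(2) vimage_mono[OF N(3), of k] by (intro exI[of _ "k -` N \<inter> - P"]) auto
    qed
    moreover have "closedin (top_of_set (- P)) (k -` (\<Union>S) \<inter> - P)"
      using clK by (auto simp: closedin_closed)
    \<comment> \<open>\<open>x\<close> may itself be a vertex, but it is a limit of points of
      \<open>f\<close> off the graph, one of which lies in the chart.\<close>
    moreover have "k -` (\<Union>S) \<inter> - P \<noteq> {}"
    proof -
      have "x \<in> X closure_of (f - ?\<Gamma>)"
        using face_component(2)[OF SF[OF f(1)]] f(2) by simp
      then obtain y where y: "y \<in> f - ?\<Gamma>" "y \<in> U"
        using open_dom ch(2) unfolding in_closure_of by blast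
      then have "k' y \<in> k -` (\<Union>S) \<inter> - P"
        using f(1) by (auto simp: P_def k_k' graph_points_def)
      then show ?thesis by blast
    qed
    ultimately have "k -` (\<Union>S) \<inter> - P = - P"
      using con unfolding connected_clopen by blast
    then have "- (k -` (\<Union>S)) \<subseteq> P" by blast
    \<comment> \<open>The uncovered points of the chart form an open set inside the finite set
      \<open>P\<close>, and a finite open set of the plane is empty. So the vertices in the chart
      are covered as well.\<close>
    then have "finite (- (k -` (\<Union>S)))"
      using finP finite_subset by blast
    then have "- (k -` (\<Union>S)) = {}"
      using finite_imp_not_open[of "- (k -` (\<Union>S))"] open_Compl[OF clK] by argo
    then have "k w \<in> \<Union>S" for w
      by blast
    then have "U \<subseteq> \<Union>S"
      using k_k' by (metis subsetI)
    then show ?thesis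
      using open_dom ch(2) by blast
  qed
  have "openin X (\<Union>S)"
    using at_vertices openin_subopen by blast
  moreover have "\<Union>S \<noteq> {}"
    using S(2) SF face_not_subset_graph by (metis Union_iff ex_in_conv)
  ultimately have "\<Union>S = topspace X"
    using X clU unfolding closed_surface_def connected_space_clopen_in by blast
  \<comment> \<open>As the union is the whole surface, this point of the missing face lies in some
    face of \<open>S\<close>, which must then equal \<open>f0\<close>.\<close>
  moreover obtain y where y: "y \<in> f0" "y \<notin> ?\<Gamma>"
    using face_not_subset_graph[OF f0(1)] .
  moreover have "f0 \<subseteq> topspace X"
    by (rule closedin_subset[OF closedin_face[OF f0(1)]])
  ultimately obtain f where "f \<in> S" and "y \<in> f" by blast
  then show False
    using faces_eqI[OF SF f0(1) _ y(1,2)] f0(2) by blast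
qed

subsection \<open>Hypercube labels\<close>

text \<open>The common elements are counted twice and cancel modulo 2.\<close>

lemma odd_card_sym_diff:
  assumes "finite A" "finite B"
  shows "odd (card (sym_diff A B)) \<longleftrightarrow> odd (card A) \<noteq> odd (card B)"
proof -
  have "card A = card (A - B) + card (A \<inter> B)"
    using card_Int_Diff[OF assms(1), of B] by simp
  moreover have "card B = card (B - A) + card (A \<inter> B)"
    using card_Int_Diff[OF assms(2), of A] by (simp add: Int_commute)
  moreover have "card (sym_diff A B) = card (A - B) + card (B - A)"
    using assms by (intro card_Un_disjoint) auto
  ultimately show ?thesis by presburger
qed

lemma adjacent_hypercube:
  "adjacent (hypercube n) a b \<longleftrightarrow>
    length a = n \<and> length b = n \<and> card {i. i < n \<and> a ! i \<noteq> b ! i} = 1"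
proof
  assume "adjacent (hypercube n) a b"
  then obtain a' b' where *: "{a, b} = {a', b'}" "length a' = n" "length b' = n"
      "card {i. i < n \<and> a' ! i \<noteq> b' ! i} = 1"
    unfolding adjacent_def hypercube_def by auto
  have "card {i. i < n \<and> b' ! i \<noteq> a' ! i} = 1"
    using *(4) by (simp only: eq_commute[of "b' ! _"])
  moreover have "a = a' \<and> b = b' \<or> a = b' \<and> b = a'"
    using *(1) by (simp add: doubleton_eq_iff)
  ultimately show "length a = n \<and> length b = n \<and> card {i. i < n \<and> a ! i \<noteq> b ! i} = 1"
    using *(2-4) by (elim disjE) simp_all
qed (auto simp: adjacent_def hypercube_def)

text \<open>Linear algebra over \<open>GF(2)\<close>, free of topology: \<open>indep\<close> states
  that the sets \<open>E f\<close> are linearly independent, so the difference of two vertices in a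
  component has unique coordinates, and adjacency means that exactly one coordinate is
  nonzero.\<close>

lemma induced_cubical_component:
  fixes R :: "'e set sgraph" and E :: "'f \<Rightarrow> 'e set"
  assumes fin: "finite F"
    and indep: "\<And>S. S \<subseteq> F \<Longrightarrow> S \<noteq> {} \<Longrightarrow> \<exists>e. odd (card {f \<in> S. e \<in> E f})"
    and adj: "\<And>A B. adjacent R A B \<longleftrightarrow>
      A \<in> gverts R \<and> B \<in> gverts R \<and> (\<exists>f\<in>F. sym_diff A B = E f)"
    and H: "H \<in> graph_components R"
  shows "induced_cubical H"
proof -
  \<comment> \<open>\<open>D S\<close> is the sum over \<open>GF(2)\<close> of the sets
    \<open>E f\<close> with \<open>f\<close> in \<open>S\<close>.\<close>
  define D where "D S = {e. odd (card {f \<in> S. e \<in> E f})}" for S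
  have D_sym_diff: "D (sym_diff S T) = sym_diff (D S) (D T)" if "S \<subseteq> F" "T \<subseteq> F" for S T
  proof -
    have "{f \<in> sym_diff S T. e \<in> E f} = sym_diff {f \<in> S. e \<in> E f} {f \<in> T. e \<in> E f}" for e
      by blast
    moreover have "finite {f \<in> S. e \<in> E f}" "finite {f \<in> T. e \<in> E f}" for e
      using finite_subset[OF that(1) fin] finite_subset[OF that(2) fin] by simp_all
    ultimately show ?thesis
      unfolding D_def by (auto simp: odd_card_sym_diff)
  qed
  \<comment> \<open>\<open>D\<close> is additive, so injectivity reduces to a trivial kernel, which
    is \<open>indep\<close>.\<close>
  have D_inj: "S = T" if "S \<subseteq> F" "T \<subseteq> F" "D S = D T" for S T
  proof (rule ccontr)
    assume "S \<noteq> T"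
    then have "sym_diff S T \<noteq> {}" "sym_diff S T \<subseteq> F"
      using that by blast+
    then have "D (sym_diff S T) \<noteq> {}"
      using indep[of "sym_diff S T"] unfolding D_def by blast
    then show False
      using that D_sym_diff[OF that(1,2)] by simp
  qed
  have D_single: "D {f} = E f" for f
  proof -
    have "{f' \<in> {f}. e \<in> E f'} = (if e \<in> E f then {f} else {})" for e
      by auto
    then show ?thesis
      unfolding D_def by simp
  qed
  obtain x where x: "H = induced_subgraph R {y. (adjacent R)\<^sup>*\<^sup>* x y}"
    using H unfolding graph_components_def by blast
  define W where "W = {y. (adjacent R)\<^sup>*\<^sup>* x y}"
  \<comment> \<open>Each step along a path from the base vertex \<open>x\<close> adds a single
    \<open>E f\<close>.\<close>
  have "\<exists>S\<subseteq>F. sym_diff x y = D S" if "(adjacent R)\<^sup>*\<^sup>* x y" for y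
    using that
  proof (induction rule: rtranclp_induct)
    case base
    have "sym_diff x x = D {}" by (simp add: D_def)
    then show ?case by blast
  next
    case (step y z)
    obtain S where S: "S \<subseteq> F" "sym_diff x y = D S"
      using step.IH by blast
    obtain f where f: "f \<in> F" "sym_diff y z = E f"
      using adj[of y z] step.hyps(2) by blast
    have "sym_diff x z = sym_diff (sym_diff x y) (sym_diff y z)"
      by blast
    also have "\<dots> = D (sym_diff S {f})"
      using D_sym_diff[of S "{f}"] S f by (simp add: D_single)
    finally show ?case
      using S(1) f(1) by (intro exI[of _ "sym_diff S {f}"]) auto
  qed
  then have "\<forall>y\<in>W. \<exists>S. S \<subseteq> F \<and> sym_diff x y = D S"
    unfolding W_def by simp
  from bchoice[OF this] obtain \<sigma> where
    \<sigma>: "\<And>y. y \<in> W \<Longrightarrow> \<sigma> y \<subseteq> F" "\<And>y. y \<in> W \<Longrightarrow> sym_diff x y = D (\<sigma> y)"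
    by auto
  \<comment> \<open>The base vertex cancels from the sum of the two differences.\<close>
  have diff: "sym_diff y z = D (sym_diff (\<sigma> y) (\<sigma> z))" if "y \<in> W" "z \<in> W" for y z
  proof -
    have "sym_diff y z = sym_diff (sym_diff x y) (sym_diff x z)"
      by auto
    then show ?thesis
      using D_sym_diff[OF \<sigma>(1)[OF that(1)] \<sigma>(1)[OF that(2)]] \<sigma>(2)[OF that(1)] \<sigma>(2)[OF that(2)]
      by simp
  qed
  have adj_card: "(\<exists>f\<in>F. sym_diff y z = E f) \<longleftrightarrow> card (sym_diff (\<sigma> y) (\<sigma> z)) = 1"
    if "y \<in> W" "z \<in> W" for y z
  proof -
    define T where "T = sym_diff (\<sigma> y) (\<sigma> z)"
    have TF: "T \<subseteq> F"
      using \<sigma>(1)[OF that(1)] \<sigma>(1)[OF that(2)] unfolding T_def by blast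
    \<comment> \<open>This excludes that a sum of several boundaries equals one \<open>E f\<close>,
      and so makes the labelling induced.\<close>
    have "D T = E f \<longleftrightarrow> T = {f}" if "f \<in> F" for f
    proof
      assume "D T = E f"
      then show "T = {f}"
        using that by (intro D_inj TF) (simp_all add: D_single)
    qed (simp add: D_single)
    then have "(\<exists>f\<in>F. D T = E f) \<longleftrightarrow> (\<exists>f. T = {f})"
      using TF by auto
    then show ?thesis
      unfolding diff[OF that] T_def[symmetric] by (simp add: card_1_singleton_iff)
  qed
  obtain fs where fs: "set fs = F" "distinct fs"
    using fin finite_distinct_list by blast
  \<comment> \<open>The last, constant, coordinate ensures \<open>n \<ge> 1\<close> when \<open>F\<close> is empty.\<close>
  define n where "n = Suc (length fs)"
  define l where "l y = map (\<lambda>f. f \<in> \<sigma> y) fs @ [False]" for y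
  have len: "length (l y) = n" for y
    by (simp add: l_def n_def)
  have l_card: "card {i. i < n \<and> l y ! i \<noteq> l z ! i} = card (sym_diff (\<sigma> y) (\<sigma> z))"
    if "y \<in> W" "z \<in> W" for y z
  proof -
    \<comment> \<open>The constant last coordinate never differs and drops out.\<close>
    have eq: "{i. i < n \<and> l y ! i \<noteq> l z ! i} = {i. i < length fs \<and> fs ! i \<in> sym_diff (\<sigma> y) (\<sigma> z)}"
      by (auto simp: n_def l_def nth_append less_Suc_eq)
    have "sym_diff (\<sigma> y) (\<sigma> z) \<subseteq> set fs"
      using \<sigma>(1)[OF that(1)] \<sigma>(1)[OF that(2)] fs(1) by blast
    then have "(!) fs ` {i. i < length fs \<and> fs ! i \<in> sym_diff (\<sigma> y) (\<sigma> z)} = sym_diff (\<sigma> y) (\<sigma> z)"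
      by (fastforce simp: in_set_conv_nth image_iff)
    moreover have "inj_on ((!) fs) {i. i < length fs \<and> fs ! i \<in> sym_diff (\<sigma> y) (\<sigma> z)}"
      using fs(2) by (auto simp: inj_on_def nth_eq_iff_index_eq)
    ultimately show ?thesis
      unfolding eq using card_image by fastforce
  qed
  have gH: "gverts H = gverts R \<inter> W"
    by (simp add: x W_def induced_subgraph_def)
  have "inj_on l (gverts H)"
  proof (rule inj_onI)
    fix y z assume yz: "y \<in> gverts H" "z \<in> gverts H" "l y = l z"
    then have W: "y \<in> W" "z \<in> W" by (auto simp: gH)
    have "card (sym_diff (\<sigma> y) (\<sigma> z)) = 0"
      using l_card[OF W] yz(3) by simp
    moreover have "finite (sym_diff (\<sigma> y) (\<sigma> z))"
      using finite_subset[OF \<sigma>(1)[OF W(1)] fin] finite_subset[OF \<sigma>(1)[OF W(2)] fin] by simp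
    ultimately have "\<sigma> y = \<sigma> z" by auto
    then have "sym_diff y z = {}"
      using diff[OF W] by (simp add: D_def)
    then show "y = z" by auto
  qed
  moreover have "l ` gverts H \<subseteq> gverts (hypercube n)"
    using len by (auto simp: hypercube_def)
  moreover have "adjacent (hypercube n) (l y) (l z) \<longleftrightarrow> adjacent H y z"
    if "y \<in> gverts H" "z \<in> gverts H" for y z
  proof -
    have W: "y \<in> W" "z \<in> W" "y \<in> gverts R" "z \<in> gverts R"
      using that by (auto simp: gH)
    have "adjacent H y z \<longleftrightarrow> adjacent R y z"
      using W by (simp add: adjacent_def x induced_subgraph_def W_def)
    also have "\<dots> \<longleftrightarrow> card (sym_diff (\<sigma> y) (\<sigma> z)) = 1"
      using adj[of y z] W adj_card[OF W(1,2)] by simp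
    finally show ?thesis
      unfolding adjacent_hypercube l_card[OF W(1,2)] by (simp add: len)
  qed
  ultimately show ?thesis
    unfolding induced_cubical_def by (intro exI[of _ n]) (auto simp: n_def)
qed

section \<open>Application to the resonance graph\<close>

lemma adjacent_resonance_graph:
  "adjacent (resonance_graph G X p c F) A B \<longleftrightarrow>
    perfect_matching G A \<and> perfect_matching G B \<and> (\<exists>f\<in>F. sym_diff A B = face_edges G X p c f)"
  unfolding adjacent_def resonance_graph_def by (auto simp: doubleton_eq_iff Un_commute)

theorem theorem1p2:
  fixes G :: "'v sgraph" and X :: "'p topology"
    and p :: "'v \<Rightarrow> 'p" and c :: "'v set \<Rightarrow> real \<Rightarrow> 'p"
    and F :: "'p set set" and H :: "'v set set sgraph"
  assumes "simple_graph G" and "finite (gverts G)"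
    and "closed_surface X"
    and "graph_embedding G X p c"
    and "\<forall>f\<in>F. even_face G X p c f"
    and "F \<noteq> faces G X p c"
    and "H \<in> graph_components (resonance_graph G X p c F)"
  shows "induced_cubical H"
proof -
  let ?E = "face_edges G X p c"
  have "F \<subseteq> faces G X p c"
    using assms(5) by (auto simp: even_face_def)
  then obtain f0 where f0: "f0 \<in> faces G X p c" "f0 \<notin> F"
    using assms(6) by blast
  \<comment> \<open>Stated for finite \<open>S\<close> first, because the finiteness of
    \<open>F\<close> is itself derived from it.\<close>
  have indep: "\<exists>e. odd (card {f \<in> S. e \<in> ?E f})" if "finite S" "S \<subseteq> F" "S \<noteq> {}" for S
    using even_faces_independent[OF assms(1-4) that(1,3) _ f0(1)] that(2) f0(2) assms(5) by blast
  \<comment> \<open>For two faces with the same boundary, every edge would be on both or on neither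
    of them, against independence. Hence \<open>F\<close> is finite, as there are only finitely many
    sets of edges.\<close>
  have "inj_on ?E F"
  proof (rule inj_onI, rule ccontr)
    fix f g assume fg: "f \<in> F" "g \<in> F" "?E f = ?E g" "f \<noteq> g"
    obtain e where "odd (card {h \<in> {f, g}. e \<in> ?E h})"
      using indep[of "{f, g}"] fg by blast
    moreover have "{h \<in> {f, g}. e \<in> ?E h} = (if e \<in> ?E f then {f, g} else {})"
      using fg(3) by auto
    ultimately show False
      using fg(4) by (simp split: if_splits)
  qed
  moreover have "?E ` F \<subseteq> Pow (Pow (gverts G))"
    using assms(1) by (auto simp: face_edges_def simple_graph_def)
  ultimately have finF: "finite F"
    using assms(2) by (meson finite_Pow_iff finite_imageD finite_subset)
  show ?thesis
  proof (rule induced_cubical_component[OF finF _ _ assms(7)])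
    show "\<exists>e. odd (card {f \<in> S. e \<in> ?E f})" if "S \<subseteq> F" "S \<noteq> {}" for S
      using indep[OF finite_subset[OF that(1) finF] that] .
    show "adjacent (resonance_graph G X p c F) A B \<longleftrightarrow>
        A \<in> gverts (resonance_graph G X p c F) \<and> B \<in> gverts (resonance_graph G X p c F) \<and>
        (\<exists>f\<in>F. sym_diff A B = ?E f)" for A B
      unfolding adjacent_resonance_graph by (simp add: resonance_graph_def)
  qed
qed

end
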